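(* Let $g:H\to\mathbb{R}$ be a real-valued function of a quaternion variable $q$, differentiable as a function of the four real components of $q$, and let $f$ be a differentiable $H$-valued function of the real variable $g$, with derivative $\partial f/\partial g$. Then for the composite function $q\mapsto f(g(q))$ and every $\nu\in\{1,i,j,k\}$, $$\frac{\partial f(g(q))}{\partial q^\nu}=\frac{\partial f}{\partial g}\,\frac{\partial g}{\partial q^\nu},$$ where $\partial f/\partial g$ is evaluated at $g(q)$.
   Context: $H$ denotes the real algebra of quaternions $q=q_a+q_bi+q_cj+q_dk$ ($q_a,q_b,q_c,q_d\in\mathbb{R}$), and a function $h:H\to H$ (in particular a real-valued one) is viewed as a function of the four real variables $q_a,q_b,q_c,q_d$. The (left) restricted HR derivatives are $$\tfrac{\partial h}{\partial q}:=\tfrac14\left(\tfrac{\partial h}{\partial q_a}-\tfrac{\partial h}{\partial q_b}i-\tfrac{\partial h}{\partial q_c}j-\tfrac{\partial h}{\partial q_d}k\right),\quad \tfrac{\partial h}{\partial q^i}:=\tfrac14\left(\tfrac{\partial h}{\partial q_a}-\tfrac{\partial h}{\partial q_b}i+\tfrac{\partial h}{\partial q_c}j+\tfrac{\partial h}{\partial q_d}k\right),$$ $$\tfrac{\partial h}{\partial q^j}:=\tfrac14\left(\tfrac{\partial h}{\partial q_a}+\tfrac{\partial h}{\partial q_b}i-\tfrac{\partial h}{\partial q_c}j+\tfrac{\partial h}{\partial q_d}k\right),\quad \tfrac{\partial h}{\partial q^k}:=\tfrac14\left(\tfrac{\partial h}{\partial q_a}+\tfrac{\partial h}{\partial q_b}i+\tfrac{\partial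 h}{\partial q_c}j-\tfrac{\partial h}{\partial q_d}k\right),$$ and $\partial/\partial q^1$ means $\partial/\partial q$. *)

theory Defs
  imports "HOL-Analysis.Analysis"
begin

datatype quat = Quat (Qa: real) (Qb: real) (Qc: real) (Qd: real)

lemma quat_eq_iff:
  "x = y \<longleftrightarrow> Qa x = Qa y \<and> Qb x = Qb y \<and> Qc x = Qc y \<and> Qd x = Qd y"
  by (auto intro: quat.expand)

definition quat_i :: quat where "quat_i = Quat 0 1 0 0"
definition quat_j :: quat where "quat_j = Quat 0 0 1 0"
definition quat_k :: quat where "quat_k = Quat 0 0 0 1"

instantiation quat :: ab_group_add
begin

definition "0 = Quat 0 0 0 0"
definition "x + y = Quat (Qa x + Qa y) (Qb x + Qb y) (Qc x + Qc y) (Qd x + Qd y)"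
definition "- x = Quat (- Qa x) (- Qb x) (- Qc x) (- Qd x)"
definition "x - y = Quat (Qa x - Qa y) (Qb x - Qb y) (Qc x - Qc y) (Qd x - Qd y)"

instance
  by standard
    (simp_all add: quat_eq_iff zero_quat_def plus_quat_def uminus_quat_def minus_quat_def)

end

instantiation quat :: real_algebra_1
begin

definition "1 = Quat 1 0 0 0"
definition "x * y = Quat
  (Qa x * Qa y - Qb x * Qb y - Qc x * Qc y - Qd x * Qd y)
  (Qa x * Qb y + Qb x * Qa y + Qc x * Qd y - Qd x * Qc y)
  (Qa x * Qc y - Qb x * Qd y + Qc x * Qa y + Qd x * Qb y)
  (Qa x * Qd y + Qb x * Qc y - Qc x * Qb y + Qd x * Qa y)"
definition "r *\<^sub>R x = Quat (r * Qa x) (r * Qb x) (r * Qc x) (r * Qd x)"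

instance
  by standard
    (simp_all add: quat_eq_iff zero_quat_def plus_quat_def one_quat_def times_quat_def
      scaleR_quat_def algebra_simps)

end

instantiation quat :: real_inner
begin

definition "x \<bullet> y = Qa x * Qa y + Qb x * Qb y + Qc x * Qc y + Qd x * Qd y"
definition "norm (x::quat) = sqrt (x \<bullet> x)"
definition "sgn (x::quat) = x /\<^sub>R norm x"
definition "dist (x::quat) y = norm (x - y)"
definition [code del]:
  "(uniformity :: (quat \<times> quat) filter) = (INF e\<in>{0 <..}. principal {(x, y). dist x y < e})"
definition [code del]:
  "open (U :: quat set) \<longleftrightarrow> (\<forall>x\<in>U. eventually (\<lambda>(x', y). x' = x \<longrightarrow> y \<in> U) uniformity)"

instance
proof
  fix x y z :: quat and r :: real
  show "x \<bullet> y = y \<bullet> x" "(x + y) \<bullet> z = x \<bullet> z + y \<bullet> z" "(r *\<^sub>R x) \<bullet> y = r * (x \<bullet> y)"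
    by (simp_all add: inner_quat_def plus_quat_def scaleR_quat_def algebra_simps)
  show "0 \<le> x \<bullet> x"
    by (simp add: inner_quat_def)
  show "x \<bullet> x = 0 \<longleftrightarrow> x = 0"
  proof
    assume "x \<bullet> x = 0"
    then have *: "Qa x * Qa x + Qb x * Qb x + Qc x * Qc x + Qd x * Qd x = 0"
      by (simp add: inner_quat_def)
    have "Qa x * Qa x \<ge> 0" "Qb x * Qb x \<ge> 0" "Qc x * Qc x \<ge> 0" "Qd x * Qd x \<ge> 0"
      by simp_all
    with * have "Qa x * Qa x = 0" "Qb x * Qb x = 0" "Qc x * Qc x = 0" "Qd x * Qd x = 0"
      by linarith+
    then show "x = 0"
      by (simp add: quat_eq_iff zero_quat_def)
  qed (simp add: inner_quat_def zero_quat_def)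
qed (rule norm_quat_def sgn_quat_def dist_quat_def uniformity_quat_def open_quat_def)+

end

instance quat :: real_normed_algebra_1
proof
  fix x y :: quat
  have *: "(a*x - b*y - c*z - d*w)\<^sup>2 + (a*y + b*x + c*w - d*z)\<^sup>2 +
      (a*z - b*w + c*x + d*y)\<^sup>2 + (a*w + b*z - c*y + d*x)\<^sup>2 =
      (a\<^sup>2 + b\<^sup>2 + c\<^sup>2 + d\<^sup>2) * (x\<^sup>2 + y\<^sup>2 + z\<^sup>2 + w\<^sup>2)" for a b c d x y z w :: real
    by (simp add: power2_eq_square algebra_simps)
  have "(x * y) \<bullet> (x * y) = (x \<bullet> x) * (y \<bullet> y)"
    by (simp only: inner_quat_def times_quat_def quat.sel power2_eq_square [symmetric] *)
  then show "norm (x * y) \<le> norm x * norm y"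
    by (simp add: norm_quat_def real_sqrt_mult)
  show "norm (1 :: quat) = 1"
    by (simp add: norm_quat_def inner_quat_def one_quat_def)
qed

instantiation quat :: euclidean_space
begin

definition "Basis = {1, quat_i, quat_j, quat_k}"

lemma inner_quat_units [simp]:
  "x \<bullet> 1 = Qa x" "x \<bullet> quat_i = Qb x" "x \<bullet> quat_j = Qc x" "x \<bullet> quat_k = Qd x" for x :: quat
  by (simp_all add: inner_quat_def one_quat_def quat_i_def quat_j_def quat_k_def)

instance
proof
  show "(Basis :: quat set) \<noteq> {}" "finite (Basis :: quat set)"
    by (simp_all add: Basis_quat_def)
next
  fix u v :: quat
  assume "u \<in> Basis" "v \<in> Basis"
  then have "u = 1 \<or> u = quat_i \<or> u = quat_j \<or> u = quat_k"
    and "v = 1 \<or> v = quat_i \<or> v = quat_j \<or> v = quat_k"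
    by (simp_all only: Basis_quat_def insert_iff empty_iff simp_thms)
  then show "u \<bullet> v = (if u = v then 1 else 0)"
    by (elim disjE; hypsubst)
      (simp_all only: inner_quat_units,
        simp_all add: one_quat_def quat_i_def quat_j_def quat_k_def)
next
  fix x :: quat
  show "(\<forall>u\<in>Basis. x \<bullet> u = 0) \<longleftrightarrow> x = 0"
    by (simp add: Basis_quat_def quat_eq_iff zero_quat_def)
qed

end

text \<open>Partial derivatives with respect to the four real components; they are meaningful
  where the corresponding partial function is differentiable.\<close>

definition partial_a :: "(quat \<Rightarrow> quat) \<Rightarrow> quat \<Rightarrow> quat" where
  "partial_a h q = vector_derivative (\<lambda>t. h (Quat t (Qb q) (Qc q) (Qd q))) (at (Qa q))"
definition partial_b :: "(quat \<Rightarrow> quat) \<Rightarrow> quat \<Rightarrow> quat" where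
  "partial_b h q = vector_derivative (\<lambda>t. h (Quat (Qa q) t (Qc q) (Qd q))) (at (Qb q))"
definition partial_c :: "(quat \<Rightarrow> quat) \<Rightarrow> quat \<Rightarrow> quat" where
  "partial_c h q = vector_derivative (\<lambda>t. h (Quat (Qa q) (Qb q) t (Qd q))) (at (Qc q))"
definition partial_d :: "(quat \<Rightarrow> quat) \<Rightarrow> quat \<Rightarrow> quat" where
  "partial_d h q = vector_derivative (\<lambda>t. h (Quat (Qa q) (Qb q) (Qc q) t)) (at (Qd q))"

datatype hr_index = HR1 | HRi | HRj | HRk

text \<open>The imaginary units multiply the partial derivatives from the right.\<close>

primrec HR_deriv :: "hr_index \<Rightarrow> (quat \<Rightarrow> quat) \<Rightarrow> quat \<Rightarrow> quat" where
  "HR_deriv HR1 h q = (1/4) *\<^sub>R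
     (partial_a h q - partial_b h q * quat_i - partial_c h q * quat_j - partial_d h q * quat_k)"
| "HR_deriv HRi h q = (1/4) *\<^sub>R
     (partial_a h q - partial_b h q * quat_i + partial_c h q * quat_j + partial_d h q * quat_k)"
| "HR_deriv HRj h q = (1/4) *\<^sub>R
     (partial_a h q + partial_b h q * quat_i - partial_c h q * quat_j + partial_d h q * quat_k)"
| "HR_deriv HRk h q = (1/4) *\<^sub>R
     (partial_a h q + partial_b h q * quat_i + partial_c h q * quat_j - partial_d h q * quat_k)"

end

theory Submission
  imports Defs
begin

text \<open>
  An HR derivative is a real combination of terms \<open>D * u\<close>, where \<open>D\<close> is a partial derivative along
  a coordinate line and the unit \<open>u\<close> stands on the right. On a coordinate line both \<open>q \<mapsto> f (g q)\<close>
  and \<open>q \<mapsto> g q\<close> are functions of one real variable, so the classical chain rule applies, and it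
  pulls the factor \<open>f'(g q)\<close> out of each partial derivative. Since \<open>g\<close> is real-valued, its partial
  derivatives are real and commute with \<open>f'(g q)\<close>; hence that factor can be placed on the left, away
  from the units, and associativity and distributivity pull it out of the whole combination.
\<close>

text \<open>The chain rule yields a real multiple of the outer derivative. Embedding the real factor
  with \<open>of_real\<close> turns this into a product whose left factor survives a later multiplication by a
  unit from the right.\<close>

lemma vector_derivative_chain_of_real:
  fixes f :: "real \<Rightarrow> 'a::real_normed_algebra_1" and \<phi> :: "real \<Rightarrow> real"
  assumes "\<phi> differentiable (at t)" and "f differentiable (at (\<phi> t))"
  shows "vector_derivative (\<lambda>s. f (\<phi> s)) (at t) =
    vector_derivative f (at (\<phi> t)) * vector_derivative (\<lambda>s. of_real (\<phi> s)) (at t)"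
proof -
  define f' where "f' = vector_derivative f (at (\<phi> t))"
  have f': "(f has_vector_derivative f') (at (\<phi> t))"
    using assms(2) by (simp add: f'_def vector_derivative_works)
  obtain D where D: "(\<phi> has_vector_derivative D) (at t)"
    using assms(1) by (metis vector_derivative_works)
  have "((\<lambda>s. f (\<phi> s)) has_vector_derivative D *\<^sub>R f') (at t)"
    using vector_diff_chain_at[OF D f'] by (simp add: o_def)
  moreover have "((\<lambda>s. of_real (\<phi> s)) has_vector_derivative (of_real D :: 'a)) (at t)"
    using D by (intro has_vector_derivative_of_real)
      (simp add: has_real_derivative_iff_has_vector_derivative)
  ultimately show ?thesis
    by (simp add: vector_derivative_at f'_def[symmetric] of_real_def)
qed

lemma differentiable_coordinate_lines:
  "(\<lambda>t. Quat t b c d) differentiable (at x)"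
  "(\<lambda>t. Quat a t c d) differentiable (at x)"
  "(\<lambda>t. Quat a b t d) differentiable (at x)"
  "(\<lambda>t. Quat a b c t) differentiable (at x)"
proof -
  have affine: "(\<lambda>t. t *\<^sub>R u + v) differentiable (at x)" for u v :: quat
    by (intro differentiable_add differentiable_scaleR differentiable_ident differentiable_const)
  show "(\<lambda>t. Quat t b c d) differentiable (at x)"
    using affine[of 1 "Quat 0 b c d"]
    by (simp add: plus_quat_def scaleR_quat_def one_quat_def)
  show "(\<lambda>t. Quat a t c d) differentiable (at x)"
    using affine[of quat_i "Quat a 0 c d"]
    by (simp add: plus_quat_def scaleR_quat_def quat_i_def)
  show "(\<lambda>t. Quat a b t d) differentiable (at x)"
    using affine[of quat_j "Quat a b 0 d"]
    by (simp add: plus_quat_def scaleR_quat_def quat_j_def)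
  show "(\<lambda>t. Quat a b c t) differentiable (at x)"
    using affine[of quat_k "Quat a b c 0"]
    by (simp add: plus_quat_def scaleR_quat_def quat_k_def)
qed

lemma partial_chain:
  fixes g :: "quat \<Rightarrow> real" and f :: "real \<Rightarrow> quat"
  assumes g: "g differentiable (at q)" and f: "f differentiable (at (g q))"
  shows
    "partial_a (\<lambda>q. f (g q)) q = vector_derivative f (at (g q)) * partial_a (\<lambda>q. of_real (g q)) q"
    "partial_b (\<lambda>q. f (g q)) q = vector_derivative f (at (g q)) * partial_b (\<lambda>q. of_real (g q)) q"
    "partial_c (\<lambda>q. f (g q)) q = vector_derivative f (at (g q)) * partial_c (\<lambda>q. of_real (g q)) q"
    "partial_d (\<lambda>q. f (g q)) q = vector_derivative f (at (g q)) * partial_d (\<lambda>q. of_real (g q)) q"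
proof -
  have along: "vector_derivative (\<lambda>s. f (g (p s))) (at t) =
      vector_derivative f (at (g q)) * vector_derivative (\<lambda>s. of_real (g (p s))) (at t)"
    if p: "p differentiable (at t)" and pt: "p t = q" for p t
  proof -
    have "(\<lambda>s. g (p s)) differentiable (at t)"
      using differentiable_chain_at[of p t g] p g pt by (simp add: o_def)
    from vector_derivative_chain_of_real[OF this, of f] show ?thesis
      using f pt by simp
  qed
  show
    "partial_a (\<lambda>q. f (g q)) q = vector_derivative f (at (g q)) * partial_a (\<lambda>q. of_real (g q)) q"
    "partial_b (\<lambda>q. f (g q)) q = vector_derivative f (at (g q)) * partial_b (\<lambda>q. of_real (g q)) q"
    "partial_c (\<lambda>q. f (g q)) q = vector_derivative f (at (g q)) * partial_c (\<lambda>q. of_real (g q)) q"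
    "partial_d (\<lambda>q. f (g q)) q = vector_derivative f (at (g q)) * partial_d (\<lambda>q. of_real (g q)) q"
    unfolding partial_a_def partial_b_def partial_c_def partial_d_def
    by (rule along, rule differentiable_coordinate_lines, simp)+
qed

theorem mainTheorem9:
  fixes g :: "quat \<Rightarrow> real" and f :: "real \<Rightarrow> quat"
  assumes "\<And>q. g differentiable (at q)"
    and "\<And>t. f differentiable (at t)"
  shows "HR_deriv \<nu> (\<lambda>q. f (g q)) q =
    vector_derivative f (at (g q)) * HR_deriv \<nu> (\<lambda>q. of_real (g q)) q"
  by (cases \<nu>) (simp_all add: partial_chain[OF assms] algebra_simps)

end
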